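(* The competitive ratio of the deterministic online algorithm $\mathrm{gCHASE}_s$ for problem SP is $3$. Here $\mathrm{gCHASE}_s$ sets $s_0\leftarrow 0$ and, for $t=1,2,\dots,T$, upon receiving $\sigma_t$ computes $\Delta(t)$ and sets $s_t\leftarrow 0$ if $\Delta(t)=-\beta$, $s_t\leftarrow 1$ if $\Delta(t)=0$, and $s_t\leftarrow s_{t-1}$ otherwise.
   Context: Fix a horizon $T\in\mathbb{N}$, a constant cancellation fee $\beta>0$ and a constant $H$. At each time $t\in\{1,\dots,T\}$ an input $\sigma_t=(e_t,p^0_t,p^1_t,B_t)$ determines a cost function $g_t:\{0,1\}\to\mathbb{R}$ by $g_t(1)=e_t p^1_t$ and $g_t(0)=e_t p^0_t+(p^1_t-p^0_t)(e_t-1.1B_t)^+-H(0.9B_t-e_t)^+$, where $(x)^+=\max\{x,0\}$; these cost functions are taken to be nonnegative. Problem SP: given $\boldsymbol{\sigma}=(\sigma_1,\dots,\sigma_T)$, minimize $\mathrm{Cost}(\boldsymbol{s})=\sum_{t=1}^T\big(g_t(s_t)+\beta(s_t-s_{t-1})^+\big)$ over $(s_1,\dots,s_T)\in\{0,1\}^T$, with initial state $s_0=0$; $\mathrm{Opt}(s_0,\boldsymbol{\sigma})$ is the optimal value. Define $\delta(t)=g_t(0)-g_t(1)$, $\Delta(0)=-\beta$, $\Delta(t)=\min\{0,\max\{\Delta(t-1)+\delta(t),-\beta\}\}$ for $t\ge1$. A deterministic online algorithm $\mathcal{A}$ chooses each $s_t$ based only on $\sigma_1,\dots,\sigma_t$;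 it is $c$-competitive if there is a constant $\gamma(s_0)$ depending only on $s_0$ with $\mathrm{Cost}_{\mathcal{A}}(s_0,\boldsymbol{\sigma})\le c\cdot\mathrm{Opt}(s_0,\boldsymbol{\sigma})+\gamma(s_0)$ for all input sequences $\boldsymbol{\sigma}$; its competitive ratio is the smallest such $c$. *)

theory Defs
  imports Complex_Main "HOL-Library.FuncSet"
begin

text \<open>Input of one time slot, \<open>\<sigma>\<^sub>t = (e\<^sub>t, p\<^sup>0\<^sub>t, p\<^sup>1\<^sub>t, B\<^sub>t)\<close>. An input sequence is
  a function \<open>nat \<Rightarrow> slot\<close> of which only the values at times \<open>1, \<dots>, T\<close> matter.\<close>

datatype slot = Slot (demand: real) (price0: real) (price1: real) (baseline: real)

text \<open>\<open>g H x s\<close> is meant for \<open>s \<in> {0, 1}\<close>.\<close>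

definition g :: "real \<Rightarrow> slot \<Rightarrow> nat \<Rightarrow> real" where
  "g H x s =
     (if s = 1 then demand x * price1 x
      else demand x * price0 x
         + (price1 x - price0 x) * max (demand x - 1.1 * baseline x) 0
         - H * max (0.9 * baseline x - demand x) 0)"

definition admissible :: "real \<Rightarrow> nat \<Rightarrow> (nat \<Rightarrow> slot) \<Rightarrow> bool" where
  "admissible H T \<sigma> \<longleftrightarrow> (\<forall>t\<in>{1..T}. \<forall>s\<in>{0, 1}. 0 \<le> g H (\<sigma> t) s)"

definition cost :: "real \<Rightarrow> real \<Rightarrow> nat \<Rightarrow> (nat \<Rightarrow> slot) \<Rightarrow> (nat \<Rightarrow> nat) \<Rightarrow> real" where
  "cost \<beta> H T \<sigma> s =
     (\<Sum>t = 1..T. g H (\<sigma> t) (s t) + \<beta> * max (real (s t) - real (s (t - 1))) 0)"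

definition schedules :: "nat \<Rightarrow> nat \<Rightarrow> (nat \<Rightarrow> nat) set" where
  "schedules s0 T = {s \<in> {0..T} \<rightarrow>\<^sub>E {0, 1}. s 0 = s0}"

definition opt :: "real \<Rightarrow> real \<Rightarrow> nat \<Rightarrow> nat \<Rightarrow> (nat \<Rightarrow> slot) \<Rightarrow> real" where
  "opt \<beta> H s0 T \<sigma> = Min (cost \<beta> H T \<sigma> ` schedules s0 T)"

text \<open>An algorithm maps an input sequence to the resulting sequence of states.\<close>

type_synonym algorithm = "(nat \<Rightarrow> slot) \<Rightarrow> nat \<Rightarrow> nat"

definition deterministic_online :: "nat \<Rightarrow> algorithm \<Rightarrow> bool" where
  "deterministic_online s0 A \<longleftrightarrow>
     (\<forall>\<sigma>. A \<sigma> 0 = s0) \<and>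
     (\<forall>\<sigma> t. A \<sigma> t \<in> {0, 1}) \<and>
     (\<forall>\<sigma> \<sigma>' t. (\<forall>i\<in>{1..t}. \<sigma> i = \<sigma>' i) \<longrightarrow> A \<sigma> t = A \<sigma>' t)"

text \<open>The additive constant depends on the initial state only, so it is chosen before the
  horizon \<open>T\<close> and the inputs. This order matters: a constant depending on \<open>T\<close> could absorb
  all switching costs.\<close>

definition competitive :: "real \<Rightarrow> real \<Rightarrow> nat \<Rightarrow> algorithm \<Rightarrow> real \<Rightarrow> bool" where
  "competitive \<beta> H s0 A c \<longleftrightarrow>
     (\<exists>\<gamma>::real. \<forall>T \<sigma>. admissible H T \<sigma> \<longrightarrow>
        cost \<beta> H T \<sigma> (A \<sigma>) \<le> c * opt \<beta> H s0 T \<sigma> + \<gamma>)"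

definition is_competitive_ratio :: "real \<Rightarrow> real \<Rightarrow> nat \<Rightarrow> algorithm \<Rightarrow> real \<Rightarrow> bool" where
  "is_competitive_ratio \<beta> H s0 A r \<longleftrightarrow>
     competitive \<beta> H s0 A r \<and> (\<forall>c. competitive \<beta> H s0 A c \<longrightarrow> r \<le> c)"

definition \<delta> :: "real \<Rightarrow> (nat \<Rightarrow> slot) \<Rightarrow> nat \<Rightarrow> real" where
  "\<delta> H \<sigma> t = g H (\<sigma> t) 0 - g H (\<sigma> t) 1"

primrec \<Delta> :: "real \<Rightarrow> real \<Rightarrow> (nat \<Rightarrow> slot) \<Rightarrow> nat \<Rightarrow> real" where
  "\<Delta> \<beta> H \<sigma> 0 = - \<beta>"
| "\<Delta> \<beta> H \<sigma> (Suc t) = min 0 (max (\<Delta> \<beta> H \<sigma> t + \<delta> H \<sigma> (Suc t)) (- \<beta>))"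

primrec gCHASE :: "real \<Rightarrow> real \<Rightarrow> algorithm" where
  "gCHASE \<beta> H \<sigma> 0 = 0"
| "gCHASE \<beta> H \<sigma> (Suc t) =
     (if \<Delta> \<beta> H \<sigma> (Suc t) = - \<beta> then 0
      else if \<Delta> \<beta> H \<sigma> (Suc t) = 0 then 1
      else gCHASE \<beta> H \<sigma> t)"

end

theory Submission
  imports Defs
begin

text \<open>The upper bound is an amortized argument: the potential \<open>\<Phi>\<close>, depending on \<open>\<Delta>(t)\<close>, the
  state of the algorithm and the state of an arbitrary offline schedule, absorbs in each slot the
  excess of the algorithm's cost over three times the offline cost. It starts at its minimum
  \<open>- \<beta>\<close>, so no additive constant is needed.

  For the lower bound, repeat four slots with \<open>(g(0), g(1))\<close> equal to \<open>(\<beta> - \<epsilon>, 0)\<close>, \<open>(\<epsilon>, 0)\<close>,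
  \<open>(0, \<beta> - \<epsilon>)\<close>, \<open>(0, \<epsilon>)\<close>. The algorithm switches only in the second and the fourth slot of each
  round, so it pays \<open>3\<beta> - 2\<epsilon>\<close> per round, while staying in state 0 costs \<open>\<beta>\<close>.\<close>

subsection \<open>Upper bound\<close>

lemma \<Delta>_bounds:
  assumes "0 \<le> \<beta>"
  shows "- \<beta> \<le> \<Delta> \<beta> H \<sigma> t" "\<Delta> \<beta> H \<sigma> t \<le> 0"
  using assms by (cases t; simp)+

lemma gCHASE_binary: "gCHASE \<beta> H \<sigma> t \<in> {0, 1}"
  by (induction t) auto

lemma \<Delta>_cong:
  assumes "\<forall>i\<in>{1..t}. \<sigma> i = \<sigma>' i"
  shows "\<Delta> \<beta> H \<sigma> t = \<Delta> \<beta> H \<sigma>' t"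
  using assms by (induction t) (auto simp: \<delta>_def)

lemma gCHASE_cong:
  assumes "\<forall>i\<in>{1..t}. \<sigma> i = \<sigma>' i"
  shows "gCHASE \<beta> H \<sigma> t = gCHASE \<beta> H \<sigma>' t"
  using assms
proof (induction t)
  case (Suc t)
  have "\<Delta> \<beta> H \<sigma> (Suc t) = \<Delta> \<beta> H \<sigma>' (Suc t)"
    using Suc.prems by (rule \<Delta>_cong)
  moreover have "gCHASE \<beta> H \<sigma> t = gCHASE \<beta> H \<sigma>' t"
    using Suc by simp
  ultimately show ?case
    by (simp only: gCHASE.simps)
qed simp

lemma deterministic_online_gCHASE: "deterministic_online 0 (gCHASE \<beta> H)"
  unfolding deterministic_online_def using gCHASE_binary gCHASE_cong by auto

text \<open>The table splits as a sum: \<open>D\<close> or \<open>- 2 * D\<close> for offline state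
  0 or 1, plus \<open>D + \<beta>\<close> if the algorithm is in state 0. At \<open>D = 0\<close>
  the last term equals \<beta> and pays for the algorithm's switch to 1; at
  \<open>D = - \<beta>\<close> it vanishes, so the switch back is neutral.\<close>

definition \<Phi> :: "real \<Rightarrow> real \<Rightarrow> nat \<Rightarrow> nat \<Rightarrow> real" where
  "\<Phi> \<beta> D a s =
     (if s = 0 then if a = 0 then 2 * D + \<beta> else D
      else if a = 0 then \<beta> - D else - 2 * D)"

lemma \<Phi>_lower:
  assumes "- \<beta> \<le> D" "D \<le> 0" "0 \<le> \<beta>"
  shows "- \<beta> \<le> \<Phi> \<beta> D a s"
  using assms by (auto simp: \<Phi>_def)

text \<open>An offline switch to 1 raises the potential by \<open>- 3 * D\<close>, at most 3\<beta>,
  which the tripled switching cost covers; a switch to 0 does not raise it. While \<open>D\<close>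
  moves freely, the slopes 2, 1, -1, -2 of \<Phi> in \<open>D\<close> turn the algorithm's slot cost
  into at most three times the offline one.\<close>

lemma \<Phi>_step:
  fixes a a' s s' :: nat and c :: "nat \<Rightarrow> real"
  assumes "0 < \<beta>" "- \<beta> \<le> D" "D \<le> 0" "0 \<le> c 0" "0 \<le> c 1"
    and D': "D' = min 0 (max (D + (c 0 - c 1)) (- \<beta>))"
    and a': "a' = (if D' = - \<beta> then 0 else if D' = 0 then 1 else a)"
    and "a \<in> {0, 1}" "s \<in> {0, 1}" "s' \<in> {0, 1}"
  shows "c a' + \<beta> * max (real a' - real a) 0 + \<Phi> \<beta> D' a' s'
    \<le> 3 * (c s' + \<beta> * max (real s' - real s) 0) + \<Phi> \<beta> D a s"
proof -
  \<comment> \<open>Whether \<open>D\<close> is clipped below, clipped above or not at all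
    determines the new state; each case is then linear arithmetic.\<close>
  consider (low) "D' = - \<beta>" "D + (c 0 - c 1) \<le> - \<beta>" "a' = 0"
    | (high) "D' = 0" "D + (c 0 - c 1) \<ge> 0" "a' = 1"
    | (mid) "D' = D + (c 0 - c 1)" "- \<beta> < D'" "D' < 0" "a' = a"
    using D' a' \<open>0 < \<beta>\<close> by (force simp: min_def max_def split: if_splits)
  then show ?thesis
    using assms(1-5,8-10) by cases (auto simp: \<Phi>_def)
qed

lemma cost_Suc:
  "cost \<beta> H (Suc T) \<sigma> s =
     cost \<beta> H T \<sigma> s + (g H (\<sigma> (Suc T)) (s (Suc T)) + \<beta> * max (real (s (Suc T)) - real (s T)) 0)"
  by (simp add: cost_def)

text \<open>Telescoping of \<open>\<Phi>_step\<close>; the \<open>- \<beta>\<close> on the right is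
  the potential at time 0.\<close>

lemma gCHASE_amortized:
  assumes "0 < \<beta>" "admissible H T \<sigma>" "s 0 = 0" "\<forall>t\<le>T. s t \<in> {0, 1}"
  shows "cost \<beta> H T \<sigma> (gCHASE \<beta> H \<sigma>) + \<Phi> \<beta> (\<Delta> \<beta> H \<sigma> T) (gCHASE \<beta> H \<sigma> T) (s T)
    \<le> 3 * cost \<beta> H T \<sigma> s - \<beta>"
  using assms(2,4)
proof (induction T)
  case 0
  then show ?case
    using assms by (simp add: cost_def \<Phi>_def)
next
  case (Suc T)
  have "cost \<beta> H T \<sigma> (gCHASE \<beta> H \<sigma>) + \<Phi> \<beta> (\<Delta> \<beta> H \<sigma> T) (gCHASE \<beta> H \<sigma> T) (s T)
      \<le> 3 * cost \<beta> H T \<sigma> s - \<beta>"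
    using Suc by (simp add: admissible_def)
  moreover have "g H (\<sigma> (Suc T)) (gCHASE \<beta> H \<sigma> (Suc T))
      + \<beta> * max (real (gCHASE \<beta> H \<sigma> (Suc T)) - real (gCHASE \<beta> H \<sigma> T)) 0
      + \<Phi> \<beta> (\<Delta> \<beta> H \<sigma> (Suc T)) (gCHASE \<beta> H \<sigma> (Suc T)) (s (Suc T))
    \<le> 3 * (g H (\<sigma> (Suc T)) (s (Suc T)) + \<beta> * max (real (s (Suc T)) - real (s T)) 0)
      + \<Phi> \<beta> (\<Delta> \<beta> H \<sigma> T) (gCHASE \<beta> H \<sigma> T) (s T)"
  proof (rule \<Phi>_step)
    show "\<Delta> \<beta> H \<sigma> (Suc T) = min 0 (max (\<Delta> \<beta> H \<sigma> T
        + (g H (\<sigma> (Suc T)) 0 - g H (\<sigma> (Suc T)) 1)) (- \<beta>))"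
      by (simp add: \<delta>_def)
    show "gCHASE \<beta> H \<sigma> (Suc T) = (if \<Delta> \<beta> H \<sigma> (Suc T) = - \<beta> then 0
        else if \<Delta> \<beta> H \<sigma> (Suc T) = 0 then 1 else gCHASE \<beta> H \<sigma> T)"
      by (rule gCHASE.simps)
  qed (use assms(1) Suc.prems gCHASE_binary[of \<beta> H \<sigma> T] in
      \<open>simp_all add: \<Delta>_bounds admissible_def\<close>)
  ultimately show ?case
    unfolding cost_Suc distrib_left[of 3] by argo
qed

text \<open>Schedules are fixed to \<open>undefined\<close> beyond \<open>T\<close>, which leaves
  finitely many; hence the \<open>Min\<close> in \<open>opt\<close> is attained.\<close>

lemma finite_schedules: "finite (schedules s0 T)"
  unfolding schedules_def by (rule finite_subset[of _ "{0..T} \<rightarrow>\<^sub>E {0, 1}"]) (auto intro: finite_PiE)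

lemma zero_schedule: "(\<lambda>t\<in>{0..T}. 0) \<in> schedules 0 T"
  by (simp add: schedules_def)

lemma opt_attained:
  obtains s where "s \<in> schedules 0 T" "opt \<beta> H 0 T \<sigma> = cost \<beta> H T \<sigma> s"
proof -
  have "opt \<beta> H 0 T \<sigma> \<in> cost \<beta> H T \<sigma> ` schedules 0 T"
    unfolding opt_def using finite_schedules zero_schedule by (intro Min_in) blast+
  then show thesis
    using that by blast
qed

lemma opt_nonneg:
  assumes "0 \<le> \<beta>" "admissible H T \<sigma>"
  shows "0 \<le> opt \<beta> H 0 T \<sigma>"
proof -
  obtain s where s: "s \<in> schedules 0 T" "opt \<beta> H 0 T \<sigma> = cost \<beta> H T \<sigma> s"
    by (rule opt_attained)
  have "0 \<le> g H (\<sigma> t) (s t)" if "t \<in> {1..T}" for t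
  proof -
    have "s t \<in> {0, 1}"
      using s(1) that by (auto simp: schedules_def PiE_iff)
    then show ?thesis
      using assms(2) that by (auto simp: admissible_def)
  qed
  then show ?thesis
    using assms(1) unfolding s(2) cost_def by (intro sum_nonneg add_nonneg_nonneg) auto
qed

lemma opt_le_stay:
  "opt \<beta> H 0 T \<sigma> \<le> (\<Sum>t = 1..T. g H (\<sigma> t) 0)"
proof -
  have "opt \<beta> H 0 T \<sigma> \<le> cost \<beta> H T \<sigma> (\<lambda>t\<in>{0..T}. 0)"
    unfolding opt_def using finite_schedules zero_schedule by (intro Min_le) auto
  also have "\<dots> = (\<Sum>t = 1..T. g H (\<sigma> t) 0)"
    unfolding cost_def by (intro sum.cong) auto
  finally show ?thesis .
qed

lemma competitive_gCHASE:
  assumes "0 < \<beta>"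
  shows "competitive \<beta> H 0 (gCHASE \<beta> H) 3"
  unfolding competitive_def
proof (intro exI allI impI)
  fix T \<sigma> assume adm: "admissible H T \<sigma>"
  obtain s where s: "s \<in> schedules 0 T" "opt \<beta> H 0 T \<sigma> = cost \<beta> H T \<sigma> s"
    by (rule opt_attained)
  have "s 0 = 0" "\<forall>t\<le>T. s t \<in> {0, 1}"
    using s(1) by (auto simp: schedules_def PiE_iff)
  note gCHASE_amortized[OF assms adm this]
  moreover have "- \<beta> \<le> \<Phi> \<beta> (\<Delta> \<beta> H \<sigma> T) (gCHASE \<beta> H \<sigma> T) (s T)"
    using assms by (intro \<Phi>_lower \<Delta>_bounds) auto
  ultimately show "cost \<beta> H T \<sigma> (gCHASE \<beta> H \<sigma>) \<le> 3 * opt \<beta> H 0 T \<sigma> + 0"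
    unfolding s(2) by linarith
qed

subsection \<open>Lower bound\<close>

text \<open>With demand equal to baseline both correction terms of \<open>g\<close> vanish, whatever \<open>H\<close> is.\<close>

definition price_slot :: "real \<Rightarrow> real \<Rightarrow> slot" where
  "price_slot u v = Slot 1 u v 1"

lemma g_price_slot: "g H (price_slot u v) s = (if s = 1 then v else u)"
  by (simp add: g_def price_slot_def)

definition adversary :: "real \<Rightarrow> real \<Rightarrow> nat \<Rightarrow> slot" where
  "adversary \<beta> \<epsilon> t =
     (if t mod 4 = 1 then price_slot (\<beta> - \<epsilon>) 0
      else if t mod 4 = 2 then price_slot \<epsilon> 0
      else if t mod 4 = 3 then price_slot 0 (\<beta> - \<epsilon>)
      else price_slot 0 \<epsilon>)"

lemma adversary_round:
  "adversary \<beta> \<epsilon> (Suc (4 * n)) = price_slot (\<beta> - \<epsilon>) 0"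
  "adversary \<beta> \<epsilon> (Suc (Suc (4 * n))) = price_slot \<epsilon> 0"
  "adversary \<beta> \<epsilon> (Suc (Suc (Suc (4 * n)))) = price_slot 0 (\<beta> - \<epsilon>)"
  "adversary \<beta> \<epsilon> (Suc (Suc (Suc (Suc (4 * n))))) = price_slot 0 \<epsilon>"
proof -
  have "Suc (4 * n) mod 4 = 1" "Suc (Suc (4 * n)) mod 4 = 2"
    "Suc (Suc (Suc (4 * n))) mod 4 = 3" "Suc (Suc (Suc (Suc (4 * n)))) mod 4 = 0"
    by presburger+
  then show "adversary \<beta> \<epsilon> (Suc (4 * n)) = price_slot (\<beta> - \<epsilon>) 0"
    "adversary \<beta> \<epsilon> (Suc (Suc (4 * n))) = price_slot \<epsilon> 0"
    "adversary \<beta> \<epsilon> (Suc (Suc (Suc (4 * n)))) = price_slot 0 (\<beta> - \<epsilon>)"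
    "adversary \<beta> \<epsilon> (Suc (Suc (Suc (Suc (4 * n))))) = price_slot 0 \<epsilon>"
    by (simp_all add: adversary_def)
qed

lemma admissible_adversary:
  assumes "0 \<le> \<epsilon>" "\<epsilon> \<le> \<beta>"
  shows "admissible H T (adversary \<beta> \<epsilon>)"
  using assms by (auto simp: admissible_def adversary_def g_price_slot)

lemma adversary_stay_cost: "(\<Sum>t = 1..4 * n. g H (adversary \<beta> \<epsilon> t) 0) = n * \<beta>"
proof (induction n)
  case (Suc n)
  have four: "4 * Suc n = Suc (Suc (Suc (Suc (4 * n))))"
    by simp
  show ?case
    unfolding four using Suc by (simp add: adversary_round g_price_slot distrib_right)
qed simp

text \<open>Each round takes \<Delta> through -\<beta>, -\<epsilon>, 0, -(\<beta> - \<epsilon>),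
  -\<beta>. The values strictly inside make the algorithm hold its state, so it pays \<beta> -
  \<epsilon>, the fee \<beta>, \<beta> - \<epsilon> and 0. The first two conjuncts restart the next
  round from the same configuration.\<close>

lemma gCHASE_adversary:
  assumes "0 < \<epsilon>" "\<epsilon> < \<beta>"
  shows "\<Delta> \<beta> H (adversary \<beta> \<epsilon>) (4 * n) = - \<beta> \<and>
    gCHASE \<beta> H (adversary \<beta> \<epsilon>) (4 * n) = 0 \<and>
    cost \<beta> H (4 * n) (adversary \<beta> \<epsilon>) (gCHASE \<beta> H (adversary \<beta> \<epsilon>)) = n * (3 * \<beta> - 2 * \<epsilon>)"
proof (induction n)
  case 0
  then show ?case by (simp add: cost_def)
next
  case (Suc n)
  let ?\<sigma> = "adversary \<beta> \<epsilon>"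
  let ?t = "4 * n"
  have four: "4 * Suc n = Suc (Suc (Suc (Suc ?t)))"
    by simp
  have \<Delta>1: "\<Delta> \<beta> H ?\<sigma> (Suc ?t) = - \<epsilon>"
    using Suc assms by (simp add: \<delta>_def adversary_round g_price_slot)
  have a1: "gCHASE \<beta> H ?\<sigma> (Suc ?t) = 0"
    using Suc assms unfolding gCHASE.simps \<Delta>1 by simp
  have \<Delta>2: "\<Delta> \<beta> H ?\<sigma> (Suc (Suc ?t)) = 0"
    using assms unfolding \<Delta>.simps(2)[of _ _ _ "Suc ?t"] \<Delta>1
    by (simp add: \<delta>_def adversary_round g_price_slot)
  have a2: "gCHASE \<beta> H ?\<sigma> (Suc (Suc ?t)) = 1"
    using assms unfolding gCHASE.simps \<Delta>2 by simp
  have \<Delta>3: "\<Delta> \<beta> H ?\<sigma> (Suc (Suc (Suc ?t))) = - (\<beta> - \<epsilon>)"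
    using assms unfolding \<Delta>.simps(2)[of _ _ _ "Suc (Suc ?t)"] \<Delta>2
    by (simp add: \<delta>_def adversary_round g_price_slot)
  have a3: "gCHASE \<beta> H ?\<sigma> (Suc (Suc (Suc ?t))) = 1"
    using assms a2 unfolding gCHASE.simps(2)[of _ _ _ "Suc (Suc ?t)"] \<Delta>3 by simp
  have \<Delta>4: "\<Delta> \<beta> H ?\<sigma> (Suc (Suc (Suc (Suc ?t)))) = - \<beta>"
    using assms unfolding \<Delta>.simps(2)[of _ _ _ "Suc (Suc (Suc ?t))"] \<Delta>3
    by (simp add: \<delta>_def adversary_round g_price_slot)
  have a4: "gCHASE \<beta> H ?\<sigma> (Suc (Suc (Suc (Suc ?t)))) = 0"
    unfolding gCHASE.simps \<Delta>4 by simp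
  have "cost \<beta> H (4 * Suc n) ?\<sigma> (gCHASE \<beta> H ?\<sigma>) = Suc n * (3 * \<beta> - 2 * \<epsilon>)"
    using Suc unfolding four cost_Suc a1 a2 a3 a4
    by (simp add: adversary_round g_price_slot distrib_right)
  then show ?case
    using \<Delta>4 a4 unfolding four by blast
qed

lemma competitive_gCHASE_lower:
  assumes "0 < \<beta>" "competitive \<beta> H 0 (gCHASE \<beta> H) c"
  shows "3 \<le> c"
proof (rule ccontr)
  assume "\<not> 3 \<le> c"
  \<comment> \<open>A negative factor would reverse the upper estimate of \<open>opt\<close> by the
    cost of staying in state 0.\<close>
  define c' where "c' = max c 0"
  have c': "0 \<le> c'" "c' < 3" "c \<le> c'"
    using \<open>\<not> 3 \<le> c\<close> by (auto simp: c'_def)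
  \<comment> \<open>With this choice 3\<beta> - 2\<epsilon> exceeds c'\<beta> by (3 - c')\<beta> /
    2, so every round adds a fixed positive amount that \<gamma> would have to absorb.\<close>
  define \<epsilon> where "\<epsilon> = (3 - c') * \<beta> / 4"
  have "(3 - c') * \<beta> < 4 * \<beta>"
    using assms(1) c' by (intro mult_strict_right_mono) auto
  then have \<epsilon>: "0 < \<epsilon>" "\<epsilon> < \<beta>"
    using assms(1) c' by (auto simp: \<epsilon>_def)
  obtain \<gamma> where \<gamma>: "\<And>T \<sigma>. admissible H T \<sigma> \<Longrightarrow>
      cost \<beta> H T \<sigma> (gCHASE \<beta> H \<sigma>) \<le> c * opt \<beta> H 0 T \<sigma> + \<gamma>"
    using assms(2) unfolding competitive_def by blast
  have bound: "n * ((3 - c') * \<beta> / 2) \<le> \<gamma>" for n :: nat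
  proof -
    let ?\<sigma> = "adversary \<beta> \<epsilon>"
    have adm: "admissible H (4 * n) ?\<sigma>"
      using \<epsilon> by (intro admissible_adversary) auto
    have "n * (3 * \<beta> - 2 * \<epsilon>) \<le> c * opt \<beta> H 0 (4 * n) ?\<sigma> + \<gamma>"
      using \<gamma>[OF adm] gCHASE_adversary[OF \<epsilon>, of H n] by simp
    also have "c * opt \<beta> H 0 (4 * n) ?\<sigma> \<le> c' * opt \<beta> H 0 (4 * n) ?\<sigma>"
      using c' opt_nonneg[OF _ adm] assms(1) by (intro mult_right_mono) auto
    also have "\<dots> \<le> c' * (n * \<beta>)"
      using c' opt_le_stay[of \<beta> H "4 * n" ?\<sigma>] unfolding adversary_stay_cost
      by (intro mult_left_mono) auto
    finally have "n * (3 * \<beta> - 2 * \<epsilon>) \<le> c' * (n * \<beta>) + \<gamma>"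
      by simp
    then show ?thesis
      by (simp add: \<epsilon>_def field_simps)
  qed
  have "0 < (3 - c') * \<beta> / 2"
    using assms(1) c' by simp
  then obtain n :: nat where "\<gamma> < n * ((3 - c') * \<beta> / 2)"
    using reals_Archimedean3 by blast
  then show False
    using bound[of n] by linarith
qed

theorem theorem3:
  fixes \<beta> H :: real
  assumes "\<beta> > 0"
  shows "deterministic_online 0 (gCHASE \<beta> H) \<and>
         is_competitive_ratio \<beta> H 0 (gCHASE \<beta> H) 3"
  using deterministic_online_gCHASE competitive_gCHASE[OF assms]
    competitive_gCHASE_lower[OF assms]
  unfolding is_competitive_ratio_def by blast

end
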